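(* Let $m\ge 2$ be an integer, and let $a_{ik}$ ($i=2,\dots,m$; $k=0,1,\dots,m$) be real numbers with $a_{ik}\ge 0$ and $\sum_{k=0}^m a_{ik}=1$ for every $i=2,\dots,m$. Let $V_1:S^m\to S^m$, $V_1(x_0,\dots,x_m)=(x_0',\dots,x_m')$, be the operator $$x_0'=1-2x_1\sum_{i=2}^m(1-a_{i0})x_i,\qquad x_k'=2x_1\sum_{i=2}^m a_{ik}x_i,\quad k=1,2,\dots,m,$$ on the simplex $S^m=\{(x_0,x_1,\dots,x_m)\in\mathbb{R}^{m+1}: x_i\ge 0,\ \sum_{i=0}^m x_i=1\}$. Then $V_1$ has a unique fixed point in $S^m$, namely $(1,0,0,\dots,0)$ (with $m$ zeros). Moreover, for any $x^{(0)}\in S^m$ its trajectory $\{x^{(n)}\}_{n\ge 0}$, defined by $x^{(n+1)}=V_1(x^{(n)})$, tends to this fixed point exponentially fast.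
   Context: A fixed point of an operator $V$ is a solution $x$ of $V(x)=x$ in the simplex. The operator $V_1$ is the general $F$-quadratic stochastic operator on the state set $\{0,1,\dots,m\}$ with $M=\{1\}$ and $F=\{2,\dots,m\}$, that is, $x_k'=\sum_{i,j=0}^m p_{ij,k}x_ix_j$ with symmetric coefficients $p_{ij,k}=p_{ji,k}\ge 0$, $\sum_{k=0}^m p_{ij,k}=1$, where $p_{ij,0}=1$ and $p_{ij,k}=0$ for $k\neq 0$ whenever $i,j\in F\cup\{0\}$ or $i,j\in M\cup\{0\}$, and $a_{ik}=p_{1i,k}$ for $i\in F$; on $S^m$ this gives the formulas in the claim. A sequence $x^{(n)}$ tends to $x^*$ exponentially fast if there are constants $C>0$ and $q\in(0,1)$ such that $\|x^{(n)}-x^*\|\le Cq^n$ for all $n\ge 0$, where $\|\cdot\|$ is any norm on the (finite-dimensional) ambient space. *)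

theory Defs
  imports "HOL-Analysis.Analysis" "HOL-Homology.Simplices"
begin

text \<open>
  Points of the ambient space are functions \<^typ>\<open>nat \<Rightarrow> real\<close> that vanish beyond index \<open>m\<close>,
  as in the library's \<^term>\<open>standard_simplex m\<close> and \<^term>\<open>topspace (Euclidean_space (Suc m))\<close>
  (which has \<open>m + 1\<close> coordinates, numbered \<open>0, \<dots>, m\<close>).
\<close>

definition V1 :: "nat \<Rightarrow> (nat \<Rightarrow> nat \<Rightarrow> real) \<Rightarrow> (nat \<Rightarrow> real) \<Rightarrow> (nat \<Rightarrow> real)" where
  "V1 m a x = (\<lambda>k.
     if k = 0 then 1 - 2 * x 1 * (\<Sum>i=2..m. (1 - a i 0) * x i)
     else if k \<le> m then 2 * x 1 * (\<Sum>i=2..m. a i k * x i)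
     else 0)"

definition is_norm :: "nat \<Rightarrow> ((nat \<Rightarrow> real) \<Rightarrow> real) \<Rightarrow> bool" where
  "is_norm m N \<longleftrightarrow>
     (\<forall>x \<in> topspace (Euclidean_space (Suc m)).
        0 \<le> N x \<and> (N x = 0 \<longleftrightarrow> x = (\<lambda>i. 0)) \<and>
        (\<forall>c. N (\<lambda>i. c * x i) = \<bar>c\<bar> * N x) \<and>
        (\<forall>y \<in> topspace (Euclidean_space (Suc m)). N (\<lambda>i. x i + y i) \<le> N x + N y))"

text \<open>
  The constants may depend on the norm; since all norms on a finite-dimensional space are
  equivalent, requiring the estimate for every norm is the same as requiring it for one.
\<close>

definition tends_exponentially_fast ::
    "nat \<Rightarrow> (nat \<Rightarrow> nat \<Rightarrow> real) \<Rightarrow> (nat \<Rightarrow> real) \<Rightarrow> bool" where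
  "tends_exponentially_fast m X L \<longleftrightarrow>
     (\<forall>N. is_norm m N \<longrightarrow>
        (\<exists>C>0. \<exists>q. 0 < q \<and> q < 1 \<and> (\<forall>n. N (\<lambda>i. X n i - L i) \<le> C * q ^ n)))"

lemma is_norm_L2_set: "is_norm m (\<lambda>x. L2_set x {..m})"
proof -
  have "x = (\<lambda>i. 0)" if "\<forall>i\<ge>Suc m. x i = 0" "\<forall>i\<in>{..m}. x i = 0" for x :: "nat \<Rightarrow> real"
    using that by (metis atMost_iff not_less_eq_eq)
  moreover have "L2_set (\<lambda>i. c * x i) A = \<bar>c\<bar> * L2_set x A" for c and x :: "nat \<Rightarrow> real" and A
    unfolding L2_set_def
    by (simp add: power_mult_distrib real_sqrt_mult flip: sum_distrib_left)
  ultimately show ?thesis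
    unfolding is_norm_def topspace_Euclidean_space
    by (auto simp: L2_set_eq_0_iff L2_set_triangle_ineq)
qed

lemma V1_in_standard_simplex:
  assumes "m \<ge> 2"
    and a_nonneg: "\<And>i k. i \<in> {2..m} \<Longrightarrow> k \<in> {0..m} \<Longrightarrow> a i k \<ge> 0"
    and a_sum: "\<And>i. i \<in> {2..m} \<Longrightarrow> (\<Sum>k=0..m. a i k) = 1"
    and x: "x \<in> standard_simplex m"
  shows "V1 m a x \<in> standard_simplex m"
proof -
  have x_nonneg: "x i \<ge> 0" for i using x by (simp add: standard_simplex_def)
  have x_sum: "(\<Sum>i\<le>m. x i) = 1" using x by (simp add: standard_simplex_def)
  define S where "S = (\<Sum>i=2..m. (1 - a i 0) * x i)"
  have a0: "(\<Sum>k=1..m. a i k) = 1 - a i 0" if "i \<in> {2..m}" for i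
    using a_sum[OF that] by (simp add: sum.atLeast_Suc_atMost)
  have rest: "(\<Sum>k=1..m. V1 m a x k) = 2 * x 1 * S"
  proof -
    have "(\<Sum>k=1..m. V1 m a x k) = (\<Sum>k=1..m. 2 * x 1 * (\<Sum>i=2..m. a i k * x i))"
      by (rule sum.cong) (auto simp: V1_def)
    also have "\<dots> = 2 * x 1 * (\<Sum>i=2..m. \<Sum>k=1..m. a i k * x i)"
      by (subst sum.swap) (simp add: sum_distrib_left)
    also have "(\<Sum>i=2..m. \<Sum>k=1..m. a i k * x i) = S"
      unfolding S_def by (rule sum.cong) (simp_all add: a0 del: One_nat_def flip: sum_distrib_right)
    finally show ?thesis .
  qed
  have "V1 m a x 0 = 1 - 2 * x 1 * S" by (simp add: V1_def S_def)
  with rest have total: "(\<Sum>k\<le>m. V1 m a x k) = 1"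
    by (simp add: atMost_atLeast0 sum.atLeast_Suc_atMost)
  have "{..m} = {0, 1} \<union> {2..m}" using \<open>m \<ge> 2\<close> by auto
  then have "(\<Sum>i\<le>m. x i) = x 0 + x 1 + (\<Sum>i=2..m. x i)" by (simp add: sum.union_disjoint)
  with x_sum x_nonneg[of 0] have le: "x 1 + (\<Sum>i=2..m. x i) \<le> 1" by simp
  have S_le: "S \<le> (\<Sum>i=2..m. x i)"
    unfolding S_def using a_nonneg x_nonneg
    by (intro sum_mono) (simp add: mult_left_le_one_le mult_le_cancel_right1 not_less left_diff_distrib)
  have "x 1 * S \<le> x 1 * (1 - x 1)"
    using S_le le x_nonneg[of 1] by (intro mult_left_mono) auto
  also have "2 * (x 1 * (1 - x 1)) \<le> 1"
    using zero_le_power2[of "x 1 - 1/2"] by (simp add: power2_eq_square algebra_simps)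
  then have "x 1 * (1 - x 1) \<le> 1/2" by simp
  finally have V0: "V1 m a x 0 \<ge> 0" by (simp add: V1_def S_def)
  have nonneg: "V1 m a x k \<ge> 0" for k
  proof (cases "k = 0")
    case False
    then show ?thesis using a_nonneg x_nonneg
      by (auto simp: V1_def intro!: mult_nonneg_nonneg sum_nonneg)
  qed (use V0 in simp)
  have zero: "V1 m a x k = 0" if "k > m" for k using that by (simp add: V1_def)
  have "V1 m a x k \<le> 1" for k
  proof (cases "k \<le> m")
    case True
    then have "V1 m a x k \<le> (\<Sum>k\<le>m. V1 m a x k)"
      by (intro member_le_sum) (auto simp: nonneg)
    then show ?thesis by (simp add: total)
  qed (simp add: zero)
  with nonneg zero total show ?thesis by (simp add: standard_simplex_def)
qed

end

theory Submission
  imports Defs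
begin

text \<open>
  On the simplex the mass \<open>1 - x\<^sub>0 = x\<^sub>1 + (x\<^sub>2 + \<dots> + x\<^sub>m)\<close> outside state \<open>0\<close> is mapped
  to at most \<open>2 x\<^sub>1 (x\<^sub>2 + \<dots> + x\<^sub>m) \<le> (1 - x\<^sub>0)\<^sup>2 / 2 \<le> (1 - x\<^sub>0) / 2\<close>. It therefore halves at every step,
  and it dominates every coordinate of \<open>x - (1, 0, \<dots>, 0)\<close>.
\<close>

lemma is_norm_zero: "is_norm m N \<Longrightarrow> N (\<lambda>i. 0) = 0"
  unfolding is_norm_def by (drule bspec[where x = "\<lambda>i. 0"]) (simp_all add: topspace_Euclidean_space)

lemma is_norm_scale:
  "is_norm m N \<Longrightarrow> x \<in> topspace (Euclidean_space (Suc m)) \<Longrightarrow> N (\<lambda>i. c * x i) = \<bar>c\<bar> * N x"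
  unfolding is_norm_def by (drule (1) bspec) (elim conjE, erule spec)

lemma is_norm_triangle:
  "is_norm m N \<Longrightarrow> x \<in> topspace (Euclidean_space (Suc m)) \<Longrightarrow>
    y \<in> topspace (Euclidean_space (Suc m)) \<Longrightarrow> N (\<lambda>i. x i + y i) \<le> N x + N y"
  unfolding is_norm_def by (drule (1) bspec) (elim conjE, erule (1) bspec)

text \<open>Expanding \<open>z\<close> in the standard basis and applying the triangle inequality
  bounds an arbitrary norm by a weighted sum of coordinates. Convergence is demanded for every norm,
  and this reduces it to coordinatewise estimates.\<close>

lemma is_norm_le_sum:
  assumes N: "is_norm m N" and z: "z \<in> topspace (Euclidean_space (Suc m))"
  shows "N z \<le> (\<Sum>i\<le>m. \<bar>z i\<bar> * N (\<lambda>j. if j = i then 1 else 0))"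
proof -
  let ?e = "\<lambda>i j::nat. if j = i then 1 else 0::real"
  let ?E = "topspace (Euclidean_space (Suc m)) :: (nat \<Rightarrow> real) set"
  \<comment> \<open>Induction on the truncations of \<open>z\<close> to its first \<open>k\<close>
    coordinates; \<open>k \<le> Suc m\<close> keeps each newly added basis vector inside the
    space.\<close>
  have partial: "N (\<lambda>i. if i < k then z i else 0) \<le> (\<Sum>i<k. \<bar>z i\<bar> * N (?e i))"
    if "k \<le> Suc m" for k
    using that
  proof (induction k)
    case 0
    show ?case by (simp add: is_norm_zero[OF N])
  next
    case (Suc k)
    have split: "(\<lambda>i. if i < Suc k then z i else 0) =
        (\<lambda>i. (if i < k then z i else 0) + z k * ?e k i)"
      by (auto simp: less_Suc_eq)
    have e: "?e k \<in> ?E" and ze: "(\<lambda>i. z k * ?e k i) \<in> ?E"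
      and zk: "(\<lambda>i. if i < k then z i else 0) \<in> ?E"
      using Suc.prems by (auto simp: topspace_Euclidean_space)
    have "N (\<lambda>i. if i < Suc k then z i else 0) \<le>
        N (\<lambda>i. if i < k then z i else 0) + N (\<lambda>i. z k * ?e k i)"
      unfolding split by (rule is_norm_triangle[OF N zk ze])
    also have "N (\<lambda>i. z k * ?e k i) = \<bar>z k\<bar> * N (?e k)"
      by (rule is_norm_scale[OF N e])
    finally show ?case using Suc by simp
  qed
  have "(\<lambda>i. if i < Suc m then z i else 0) = z"
    using z by (auto simp: topspace_Euclidean_space)
  with partial[of "Suc m"] show ?thesis by (simp add: lessThan_Suc_atMost)
qed

text \<open>Coordinate \<open>0\<close> attains the bound, and any other coordinate up to
  \<open>m\<close> is part of the mass \<open>1 - x 0\<close>. Hence controlling this one scalar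
  controls the whole distance to the vertex.\<close>

lemma abs_diff_vertex_le:
  assumes x: "x \<in> standard_simplex m"
  shows "\<bar>x i - (if i = 0 then 1 else 0)\<bar> \<le> 1 - x 0"
proof (cases "i = 0 \<or> i > m")
  case True
  then show ?thesis using x by (auto simp: standard_simplex_def)
next
  case False
  have "x 0 + x i = (\<Sum>j\<in>{0, i}. x j)" using False by simp
  also have "\<dots> \<le> (\<Sum>j\<le>m. x j)"
    using x False by (intro sum_mono2) (auto simp: standard_simplex_def)
  finally show ?thesis using x False by (simp add: standard_simplex_def)
qed

lemma vertex_in_standard_simplex: "(\<lambda>i. if i = 0 then 1 else 0) \<in> standard_simplex m"
  by (simp add: standard_simplex_def)

lemma V1_mass_le_half:
  assumes "m \<ge> 2"
    and a_nonneg: "\<And>i. i \<in> {2..m} \<Longrightarrow> a i 0 \<ge> 0"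
    and x: "x \<in> standard_simplex m"
  shows "1 - V1 m a x 0 \<le> (1 - x 0) / 2"
proof -
  define y where "y = (\<Sum>i=2..m. x i)"
  have x_nonneg: "x i \<ge> 0" for i using x by (simp add: standard_simplex_def)
  have "{..m} = {0, 1} \<union> {2..m}" using \<open>m \<ge> 2\<close> by auto
  then have "(\<Sum>i\<le>m. x i) = x 0 + x 1 + y" by (simp add: sum.union_disjoint y_def)
  then have s: "1 - x 0 = x 1 + y" using x by (simp add: standard_simplex_def)
  have y: "y \<ge> 0" unfolding y_def by (intro sum_nonneg x_nonneg)
  \<comment> \<open>Nonnegativity of \<open>a i 0\<close> makes every weight
    \<open>1 - a i 0\<close> at most 1.\<close>
  have "(\<Sum>i=2..m. (1 - a i 0) * x i) \<le> y"
    unfolding y_def using a_nonneg x_nonneg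
    by (intro sum_mono) (simp add: left_diff_distrib)
  then have "1 - V1 m a x 0 \<le> 2 * (x 1 * y)"
    using x_nonneg[of 1] by (simp add: V1_def mult_left_mono)
  \<comment> \<open>AM-GM for \<open>x 1\<close> and \<open>y\<close>, from
    \<open>(x 1 - y)^2 \<ge> 0\<close>.\<close>
  also have "4 * (x 1 * y) \<le> (x 1 + y) * (x 1 + y)"
    using zero_le_power2[of "x 1 - y"] by (simp add: power2_eq_square algebra_simps)
  then have "2 * (x 1 * y) \<le> (x 1 + y) * (x 1 + y) / 2" by simp
  \<comment> \<open>The quadratic bound becomes linear because \<open>x 1 + y = 1 - x 0\<close> is
    at most 1.\<close>
  also have "(x 1 + y) * (x 1 + y) \<le> x 1 + y"
    using s x_nonneg[of 0] x_nonneg[of 1] y by (intro mult_left_le) auto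
  finally show ?thesis using s by simp
qed

theorem theorem2:
  fixes m :: nat and a :: "nat \<Rightarrow> nat \<Rightarrow> real"
  assumes "m \<ge> 2"
    and "\<And>i k. i \<in> {2..m} \<Longrightarrow> k \<in> {0..m} \<Longrightarrow> a i k \<ge> 0"
    and "\<And>i. i \<in> {2..m} \<Longrightarrow> (\<Sum>k=0..m. a i k) = 1"
  shows "{x \<in> standard_simplex m. V1 m a x = x} = {\<lambda>i. if i = 0 then 1 else 0} \<and>
    (\<forall>x0 \<in> standard_simplex m.
       tends_exponentially_fast m (\<lambda>n. (V1 m a ^^ n) x0) (\<lambda>i. if i = 0 then 1 else 0))"
proof
  let ?L = "\<lambda>i::nat. if i = 0 then 1 else 0::real"
  have half: "1 - V1 m a x 0 \<le> (1 - x 0) / 2" if "x \<in> standard_simplex m" for x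
    using V1_mass_le_half[OF assms(1) _ that] assms(2) by simp
  show "{x \<in> standard_simplex m. V1 m a x = x} = {?L}"
  proof (intro equalityI subsetI)
    fix x assume "x \<in> {x \<in> standard_simplex m. V1 m a x = x}"
    then have x: "x \<in> standard_simplex m" and "V1 m a x = x" by auto
    \<comment> \<open>At a fixed point the mass is at most half of itself, so it cannot be
      positive.\<close>
    with half[OF x] have "1 - x 0 \<le> 0" by simp
    then have "\<bar>x i - ?L i\<bar> \<le> 0" for i using abs_diff_vertex_le[OF x, of i] by linarith
    then have "x i = ?L i" for i by (metis abs_le_zero_iff eq_iff_diff_eq_0)
    then show "x \<in> {?L}" by auto
  next
    fix x assume "x \<in> {?L}"
    \<comment> \<open>At the vertex \<open>x 1 = 0\<close>, which kills every product term.\<close>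
    moreover have "V1 m a ?L = ?L" by (auto simp: V1_def)
    ultimately show "x \<in> {x \<in> standard_simplex m. V1 m a x = x}"
      using vertex_in_standard_simplex by auto
  qed
  show "\<forall>x0 \<in> standard_simplex m. tends_exponentially_fast m (\<lambda>n. (V1 m a ^^ n) x0) ?L"
    unfolding tends_exponentially_fast_def
  proof (intro ballI allI impI)
    fix x0 N assume x0: "x0 \<in> standard_simplex m" and N: "is_norm m N"
    define C where "C = (\<Sum>i\<le>m. N (\<lambda>j. if j = i then 1 else 0))"
    have e_nonneg: "N (\<lambda>j. if j = i then 1 else 0) \<ge> 0" if "i \<le> m" for i
      using N that by (simp add: is_norm_def topspace_Euclidean_space)
    then have "C \<ge> 0" unfolding C_def by (rule sum_nonneg) simp
    have iter: "(V1 m a ^^ n) x0 \<in> standard_simplex m" for n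
    proof (induction n)
      case (Suc n)
      then show ?case using V1_in_standard_simplex[OF assms] by simp
    qed (simp add: x0)
    have decay: "1 - (V1 m a ^^ n) x0 0 \<le> (1/2) ^ n" for n
    proof (induction n)
      case 0
      then show ?case using x0 by (simp add: standard_simplex_def)
    next
      case (Suc n)
      then show ?case using half[OF iter[of n]] by simp
    qed
    \<comment> \<open>The rate 1/2 is the halving factor of the mass. Adding 1 to \<open>C\<close>
      yields a strictly positive constant from \<open>C \<ge> 0\<close>.\<close>
    have "N (\<lambda>i. (V1 m a ^^ n) x0 i - ?L i) \<le> (C + 1) * (1/2) ^ n" for n
    proof -
      let ?z = "\<lambda>i. (V1 m a ^^ n) x0 i - ?L i"
      have "?z \<in> topspace (Euclidean_space (Suc m))"
        using iter[of n] by (auto simp: topspace_Euclidean_space standard_simplex_def)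
      then have "N ?z \<le> (\<Sum>i\<le>m. \<bar>?z i\<bar> * N (\<lambda>j. if j = i then 1 else 0))"
        by (rule is_norm_le_sum[OF N])
      \<comment> \<open>Each coordinate difference is at most the mass of the \<open>n\<close>-th
        iterate, hence at most \<open>(1/2) ^ n\<close>; the weights are nonnegative.\<close>
      also have "\<dots> \<le> (\<Sum>i\<le>m. (1/2) ^ n * N (\<lambda>j. if j = i then 1 else 0))"
        using order_trans[OF abs_diff_vertex_le[OF iter[of n]] decay[of n]] e_nonneg
        by (intro sum_mono mult_right_mono) auto
      also have "\<dots> = C * (1/2) ^ n" by (simp add: C_def sum_distrib_left mult.commute)
      also have "\<dots> \<le> (C + 1) * (1/2) ^ n" by (intro mult_right_mono) auto
      finally show ?thesis .
    qed
    then show "\<exists>C>0. \<exists>q. 0 < q \<and> q < 1 \<and>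
        (\<forall>n. N (\<lambda>i. (V1 m a ^^ n) x0 i - ?L i) \<le> C * q ^ n)"
      using \<open>C \<ge> 0\<close> by (intro exI[of _ "C + 1"] conjI exI[of _ "1/2 :: real"]) auto
  qed
qed

end
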